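(* There exists an invertible pair $(f,g)\in U_2(A_{\mathbb{R}}(\mathbb{D}))$ with $f$ positive on the real zeros of $g$ and $g$ positive on the real zeros of $f$, such that whenever $\alpha,\beta\in A_{\mathbb{R}}(\mathbb{D})$ satisfy $\alpha f+\beta g=1$, at least one of $\alpha$, $\beta$ is not invertible in $A_{\mathbb{R}}(\mathbb{D})$.
   Context: $\mathbb{D}$ is the open unit disc in $\mathbb{C}$. The disc algebra $A(\mathbb{D})$ is the algebra of functions continuous on $\overline{\mathbb{D}}$ and holomorphic in $\mathbb{D}$. $A_{\mathbb{R}}(\mathbb{D})$ is the real algebra of all $f\in A(\mathbb{D})$ with $f(z)=\overline{f(\overline{z})}$ for all $z\in\overline{\mathbb{D}}$. Functions in $A_{\mathbb{R}}(\mathbb{D})$ are real-valued on $[-1,1]$; the real zeros of such a function are its zeros in $[-1,1]$. $U_2(A_{\mathbb{R}}(\mathbb{D}))$ is the set of invertible pairs, i.e. pairs $(f,g)\in A_{\mathbb{R}}(\mathbb{D})^2$ for which there exist $\alpha,\beta\in A_{\mathbb{R}}(\mathbb{D})$ with $\alpha f+\beta g=1$. *)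

theory Defs
  imports "HOL-Complex_Analysis.Complex_Analysis"
begin

text \<open>
  Elements of the disc algebra are represented by total functions on the complex plane of which
  only the restriction to the closed unit disc matters: membership depends only on the values
  there, and identities between elements are required only there.
\<close>

definition disc_algebra :: "(complex \<Rightarrow> complex) set" where
  "disc_algebra = {f. continuous_on (cball 0 1) f \<and> f holomorphic_on (ball 0 1)}"

definition real_disc_algebra :: "(complex \<Rightarrow> complex) set" where
  "real_disc_algebra = {f \<in> disc_algebra. \<forall>z\<in>cball 0 1. f z = cnj (f (cnj z))}"

definition bezout_on_disc ::
  "(complex \<Rightarrow> complex) \<Rightarrow> (complex \<Rightarrow> complex) \<Rightarrow>
   (complex \<Rightarrow> complex) \<Rightarrow> (complex \<Rightarrow> complex) \<Rightarrow> bool" where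
  "bezout_on_disc \<alpha> \<beta> f g \<longleftrightarrow> (\<forall>z\<in>cball 0 1. \<alpha> z * f z + \<beta> z * g z = 1)"

definition invertible_pairs :: "((complex \<Rightarrow> complex) \<times> (complex \<Rightarrow> complex)) set" where
  "invertible_pairs = {(f, g). f \<in> real_disc_algebra \<and> g \<in> real_disc_algebra \<and>
     (\<exists>\<alpha>\<in>real_disc_algebra. \<exists>\<beta>\<in>real_disc_algebra. bezout_on_disc \<alpha> \<beta> f g)}"

definition invertible_in_real_disc_algebra :: "(complex \<Rightarrow> complex) \<Rightarrow> bool" where
  "invertible_in_real_disc_algebra f \<longleftrightarrow>
     f \<in> real_disc_algebra \<and> (\<exists>h\<in>real_disc_algebra. \<forall>z\<in>cball 0 1. f z * h z = 1)"

definition real_zeros :: "(complex \<Rightarrow> complex) \<Rightarrow> real set" where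
  "real_zeros f = {x \<in> {-1..1}. f (of_real x) = 0}"

lemma real_disc_algebra_real_on_interval:
  assumes "f \<in> real_disc_algebra" and "x \<in> {-1..1::real}"
  shows "f (of_real x) \<in> \<real>"
proof -
  have "complex_of_real x \<in> cball 0 1"
    using assms(2) by (auto simp: abs_le_iff)
  then have "f (of_real x) = cnj (f (cnj (of_real x)))"
    using assms(1) unfolding real_disc_algebra_def by blast
  then show ?thesis
    by (metis Reals_cnj_iff complex_cnj_complex_of_real)
qed

text \<open>Meant for \<open>f\<close> in the real disc algebra and \<open>S\<close> contained in the interval from -1 to 1,
  where \<open>f\<close> is real-valued by the preceding lemma, so that \<open>Re\<close> loses no information.\<close>

definition positive_on :: "(complex \<Rightarrow> complex) \<Rightarrow> real set \<Rightarrow> bool" where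
  "positive_on f S \<longleftrightarrow> (\<forall>x\<in>S. Re (f (of_real x)) > 0)"

end

theory Submission
  imports Defs
begin

text \<open>
  The pair is \<open>f z = z\<close> and \<open>g z = z\<^sup>2 + b\<^sup>2\<close> with a sufficiently small \<open>b > 0\<close>. It is
  invertible, since \<open>(g z - z * f z) / b\<^sup>2 = 1\<close>; the only real zero of \<open>f\<close> is \<open>0\<close>, where \<open>g\<close> is
  positive, and \<open>g\<close> has no real zeros.

  Suppose \<open>\<alpha> f + \<beta> g = 1\<close> with both \<open>\<alpha>\<close> and \<open>\<beta>\<close> invertible. Then \<open>F z = z * \<alpha> z\<close> vanishes in
  the disc only at \<open>0\<close> and takes the value \<open>1\<close> only at \<open>\<plusminus>\<i> b\<close>, so it omits \<open>0\<close> and \<open>1\<close> on the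
  annulus \<open>b < |z| < 1\<close>. For small \<open>b\<close> this annulus is so thick that its middle circle
  \<open>|z| = \<surd>b\<close> is hyperbolically short, and hence so is its image in the plane
  punctured at \<open>0\<close> and \<open>1\<close>. A short loop there can only be contractible or go around one of the
  three punctures \<open>0\<close>, \<open>1\<close>, \<open>\<infinity>\<close>, whereas the image of the circle winds once around \<open>0\<close> and
  twice around \<open>1\<close>, which is neither.

  The argument below makes this quantitative and replaces winding numbers by the maximum principle.
  If \<open>|F| \<le> 3\<close> somewhere on the middle circle, then Schottky's theorem, applied to \<open>F\<close> after
  unrolling the annulus by the exponential function, makes \<open>F\<close> almost constant on that circle
  (lemma \<open>almost_constant_on_middle_circle\<close>) and therefore almost constant inside it, although
  \<open>F 0 = 0\<close> and \<open>F (\<i> b) = 1\<close>. Otherwise \<open>|F| \<ge> 3\<close> on the whole circle, so that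
  \<open>\<phi> = 1 / \<alpha>\<close> maps the disc of radius \<open>\<surd>b\<close> into a disc of a third of that radius; such a map
  has at most one fixed point (lemma \<open>no_opposite_fixed_points\<close> covers the case at hand),
  although \<open>\<phi>\<close> fixes both \<open>\<i> b\<close> and \<open>- \<i> b\<close>.
\<close>

section \<open>Functions omitting 0 and 1 on a thick annulus\<close>

text \<open>
  Schottky's theorem bounds such a function on the half disc by a constant that depends only on the
  bound at the centre; the Schwarz lemma turns this bound into a Lipschitz estimate at the centre.
\<close>

lemma Schottky_Lipschitz_at_centre:
  fixes r :: real
  assumes "r \<ge> 0"
  obtains K where "K > 0"
    "\<And>p \<zeta>. p holomorphic_on cball 0 1 \<Longrightarrow> (\<And>z. z \<in> cball 0 1 \<Longrightarrow> p z \<noteq> 0 \<and> p z \<noteq> 1) \<Longrightarrow>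
       norm (p 0) \<le> r \<Longrightarrow> norm \<zeta> < 1/2 \<Longrightarrow> norm (p \<zeta> - p 0) \<le> K * norm \<zeta>"
proof -
  define M where "M = exp (pi * exp (pi * (2 + 2 * r + 12 * (1/2) / (1 - 1/2))))"
  have M: "M > 0" by (simp add: M_def)
  define C where "C = M + r + 1"
  have C: "C > 0" using M assms by (simp add: C_def)
  show thesis
  proof
    show "2 * C > 0" using C by simp
  next
    fix p :: "complex \<Rightarrow> complex" and \<zeta> :: complex
    assume p: "p holomorphic_on cball 0 1"
      and omits: "\<And>z. z \<in> cball 0 1 \<Longrightarrow> p z \<noteq> 0 \<and> p z \<noteq> 1"
      and p0: "norm (p 0) \<le> r" and \<zeta>: "norm \<zeta> < 1/2"
    have bound: "norm (p z) \<le> M" if "norm z \<le> 1/2" for z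
      unfolding M_def
      by (rule Schottky [OF p p0]) (use omits that in auto)
    define k where "k = (\<lambda>w. (p (w / 2) - p 0) / of_real C)"
    have "k holomorphic_on ball 0 1"
      unfolding k_def
    proof (intro holomorphic_intros)
      show "(\<lambda>w. p (w / 2)) holomorphic_on ball 0 1"
        by (rule holomorphic_on_compose_gen [of "\<lambda>w. w / 2" _ p "cball 0 1", unfolded o_def])
          (auto intro!: holomorphic_intros p)
    qed (use C in auto)
    moreover have "k 0 = 0" by (simp add: k_def)
    moreover have "norm (k w) < 1" if "norm w < 1" for w
    proof -
      have "norm (p (w/2) - p 0) \<le> norm (p (w/2)) + norm (p 0)"
        by (rule norm_triangle_ineq4)
      also have "\<dots> < C"
        using bound [of "w/2"] p0 that by (simp add: C_def norm_divide)
      finally show ?thesis using C by (simp add: k_def norm_divide)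
    qed
    moreover have "norm (2 * \<zeta>) < 1" using \<zeta> by (simp add: norm_mult)
    ultimately have "norm (k (2 * \<zeta>)) \<le> norm (2 * \<zeta>)"
      by (rule Schwarz_Lemma(1))
    then show "norm (p \<zeta> - p 0) \<le> 2 * C * norm \<zeta>"
      using C by (simp add: k_def norm_divide norm_mult field_simps)
  qed
qed

text \<open>
  The exponential function unrolls the annulus \<open>e\<^sup>-\<^sup>4\<^sup>R < |z| < 1\<close> to a strip of width \<open>4 R\<close>, which
  contains a disc of radius \<open>R\<close> around each point above the middle circle. A full turn of that
  circle has length \<open>2 \<pi>\<close> in the strip, which is a small part of the radius if \<open>R\<close> is large.
\<close>

lemma almost_constant_on_middle_circle:
  fixes r \<epsilon> :: real
  assumes "r \<ge> 0" "\<epsilon> > 0"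
  obtains R where "R > 0"
    "\<And>F z\<^sub>0 z. F holomorphic_on {z. exp (- 4 * R) < norm z \<and> norm z < 1} \<Longrightarrow>
       (\<And>z. exp (- 4 * R) < norm z \<Longrightarrow> norm z < 1 \<Longrightarrow> F z \<noteq> 0 \<and> F z \<noteq> 1) \<Longrightarrow>
       norm z\<^sub>0 = exp (- 2 * R) \<Longrightarrow> norm (F z\<^sub>0) \<le> r \<Longrightarrow> norm z = exp (- 2 * R) \<Longrightarrow>
       norm (F z - F z\<^sub>0) \<le> \<epsilon>"
proof -
  obtain K where K: "K > 0"
    and Lip: "\<And>p \<zeta>. p holomorphic_on cball 0 1 \<Longrightarrow>
       (\<And>z. z \<in> cball 0 1 \<Longrightarrow> p z \<noteq> 0 \<and> p z \<noteq> 1) \<Longrightarrow>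
       norm (p 0) \<le> r \<Longrightarrow> norm \<zeta> < 1/2 \<Longrightarrow> norm (p \<zeta> - p 0) \<le> K * norm \<zeta>"
    using Schottky_Lipschitz_at_centre [OF assms(1)] by metis
  define R where "R = pi * (3 + K / \<epsilon>)"
  have R: "R > 0" using K assms by (simp add: R_def add_pos_pos)
  have R2: "pi / R < 1/2" and RK: "K * (pi / R) \<le> \<epsilon>"
    using K assms by (simp_all add: R_def field_simps add_pos_pos)
  show thesis
  proof
    show "R > 0" by fact
  next
    fix F :: "complex \<Rightarrow> complex" and z\<^sub>0 z :: complex
    assume F: "F holomorphic_on {z. exp (- 4 * R) < norm z \<and> norm z < 1}"
      and omits: "\<And>z. exp (- 4 * R) < norm z \<Longrightarrow> norm z < 1 \<Longrightarrow> F z \<noteq> 0 \<and> F z \<noteq> 1"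
      and z0: "norm z\<^sub>0 = exp (- 2 * R)" and Fz0: "norm (F z\<^sub>0) \<le> r"
      and z: "norm z = exp (- 2 * R)"
    have nz: "z\<^sub>0 \<noteq> 0" "z \<noteq> 0" using z0 z by auto
    define e where "e = (\<lambda>\<zeta>. z\<^sub>0 * exp (of_real R * \<zeta>))"
    have e_in: "exp (- 4 * R) < norm (e \<zeta>) \<and> norm (e \<zeta>) < 1" if "\<zeta> \<in> cball 0 1" for \<zeta>
    proof -
      have "\<bar>Re \<zeta>\<bar> \<le> 1" using that abs_Re_le_cmod [of \<zeta>] by simp
      then have "\<bar>R * Re \<zeta>\<bar> \<le> R" using R by (simp add: abs_mult mult_left_le)
      moreover have "norm (e \<zeta>) = exp (- 2 * R + R * Re \<zeta>)"
        by (simp add: e_def norm_mult z0 flip: exp_add)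
      moreover have "- 4 * R < - 2 * R + R * Re \<zeta>" "- 2 * R + R * Re \<zeta> < 0"
        using R calculation(1) by linarith+
      ultimately show ?thesis by (simp only: exp_less_cancel_iff exp_less_one_iff)
    qed
    define \<zeta> where "\<zeta> = Ln (z / z\<^sub>0) / of_real R"
    have "Re (Ln (z / z\<^sub>0)) = 0"
      using nz by (simp add: norm_divide z z0)
    then have "norm (Ln (z / z\<^sub>0)) \<le> pi"
      using nz mpi_less_Im_Ln [of "z / z\<^sub>0"] Im_Ln_le_pi [of "z / z\<^sub>0"]
      by (simp add: cmod_def abs_le_iff)
    then have \<zeta>: "norm \<zeta> \<le> pi / R"
      using R by (simp add: \<zeta>_def norm_divide divide_right_mono)
    have "norm ((F \<circ> e) \<zeta> - (F \<circ> e) 0) \<le> K * norm \<zeta>"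
    proof (rule Lip)
      show "F \<circ> e holomorphic_on cball 0 1"
        by (rule holomorphic_on_compose_gen [OF _ F])
          (use e_in in \<open>auto simp: e_def intro!: holomorphic_intros\<close>)
      show "norm ((F \<circ> e) 0) \<le> r" using Fz0 by (simp add: e_def)
      show "norm \<zeta> < 1/2" using \<zeta> R2 by linarith
    qed (use e_in omits in auto)
    moreover have "e \<zeta> = z" "e 0 = z\<^sub>0"
      using R nz by (simp_all add: e_def \<zeta>_def)
    moreover have "K * norm \<zeta> \<le> \<epsilon>"
      using mult_left_mono [OF \<zeta>, of K] K RK by linarith
    ultimately show "norm (F z - F z\<^sub>0) \<le> \<epsilon>" by simp
  qed
qed

section \<open>The obstruction\<close>

lemma maximum_modulus_cball:
  fixes f :: "complex \<Rightarrow> complex"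
  assumes "f holomorphic_on cball 0 \<rho>" "\<rho> > 0"
    and "\<And>z. norm z = \<rho> \<Longrightarrow> norm (f z) \<le> B" and "norm \<xi> \<le> \<rho>"
  shows "norm (f \<xi>) \<le> B"
proof (rule maximum_modulus_frontier [of f "cball 0 \<rho>"])
  show "f holomorphic_on interior (cball 0 \<rho>)"
    using assms(1) by (rule holomorphic_on_subset) auto
qed (use assms in \<open>auto intro: holomorphic_on_imp_continuous_on\<close>)

text \<open>
  The odd part of \<open>\<phi>\<close> vanishes at \<open>0\<close>, so by the Schwarz lemma it contracts towards \<open>0\<close>; at
  opposite fixed points \<open>c\<close> and \<open>-c\<close> of \<open>\<phi>\<close> it would be the identity.
\<close>

lemma no_opposite_fixed_points:
  fixes \<phi> :: "complex \<Rightarrow> complex"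
  assumes \<phi>: "\<phi> holomorphic_on cball 0 \<rho>" and \<rho>: "\<rho> > 0"
    and bound: "\<And>z. norm z = \<rho> \<Longrightarrow> norm (\<phi> z) \<le> \<rho> / 3"
    and c: "c \<noteq> 0" "norm c < \<rho>"
  shows "\<not> (\<phi> c = c \<and> \<phi> (- c) = - c)"
proof
  assume fixed: "\<phi> c = c \<and> \<phi> (- c) = - c"
  have inside: "norm (\<phi> z) \<le> \<rho> / 3" if "norm z \<le> \<rho>" for z
    by (rule maximum_modulus_cball [OF \<phi> \<rho> bound that])
  \<comment> \<open>The factor 2 that would make this the odd part is left out: the bound by a third leaves room
      for it, and it makes the inequality at \<open>c\<close> strict.\<close>
  define s where "s = (\<lambda>w. (\<phi> (of_real \<rho> * w) - \<phi> (- (of_real \<rho> * w))) / of_real \<rho>)"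
  have scale: "norm (of_real \<rho> * w) \<le> \<rho>" if "norm w < 1" for w :: complex
    using that \<rho> by (simp add: norm_mult)
  have "s holomorphic_on ball 0 1"
    unfolding s_def
  proof (intro holomorphic_intros)
    show "(\<lambda>w. \<phi> (of_real \<rho> * w)) holomorphic_on ball 0 1"
      by (rule holomorphic_on_compose_gen [of "\<lambda>w. of_real \<rho> * w" _ \<phi>, OF _ \<phi>, unfolded o_def])
        (use scale in \<open>auto intro!: holomorphic_intros\<close>)
    show "(\<lambda>w. \<phi> (- (of_real \<rho> * w))) holomorphic_on ball 0 1"
      by (rule holomorphic_on_compose_gen [of "\<lambda>w. - (of_real \<rho> * w)" _ \<phi>, OF _ \<phi>, unfolded o_def])
        (use scale in \<open>auto intro!: holomorphic_intros\<close>)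
  qed (use \<rho> in auto)
  moreover have "s 0 = 0" by (simp add: s_def)
  moreover have "norm (s w) < 1" if "norm w < 1" for w
  proof -
    have "norm (\<phi> (of_real \<rho> * w) - \<phi> (- (of_real \<rho> * w)))
        \<le> norm (\<phi> (of_real \<rho> * w)) + norm (\<phi> (- (of_real \<rho> * w)))"
      by (rule norm_triangle_ineq4)
    also have "\<dots> \<le> \<rho> / 3 + \<rho> / 3"
      using scale [OF that] by (intro add_mono inside) auto
    also have "\<dots> < \<rho>" using \<rho> by simp
    finally show ?thesis using \<rho> by (simp add: s_def norm_divide)
  qed
  moreover have "norm (c / of_real \<rho>) < 1" using c \<rho> by (simp add: norm_divide)
  ultimately have "norm (s (c / of_real \<rho>)) \<le> norm (c / of_real \<rho>)"
    by (rule Schwarz_Lemma(1))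
  moreover have "s (c / of_real \<rho>) = 2 * (c / of_real \<rho>)"
    using \<rho> fixed by (simp add: s_def field_simps)
  ultimately show False using c \<rho> by (simp add: norm_mult norm_divide divide_le_cancel)
qed

text \<open>
  In the intended use, \<open>1 - z * \<alpha> z = \<beta> z * (z\<^sup>2 + b\<^sup>2)\<close> with a zero-free \<open>\<beta>\<close>, and the
  assumption on \<open>\<alpha>\<close> says where this function vanishes.
\<close>

lemma zero_free_multiple_of_identity_obstruction:
  obtains b :: real where "0 < b"
    "\<And>\<alpha>. \<alpha> holomorphic_on ball 0 1 \<Longrightarrow> (\<And>z. z \<in> ball 0 1 \<Longrightarrow> \<alpha> z \<noteq> 0) \<Longrightarrow>
       \<not> (\<forall>z\<in>ball 0 1. z * \<alpha> z = 1 \<longleftrightarrow> z\<^sup>2 + (of_real b)\<^sup>2 = 0)"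
proof -
  obtain R where R: "R > 0"
    and circle: "\<And>F z\<^sub>0 z. F holomorphic_on {z. exp (- 4 * R) < norm z \<and> norm z < 1} \<Longrightarrow>
       (\<And>z. exp (- 4 * R) < norm z \<Longrightarrow> norm z < 1 \<Longrightarrow> F z \<noteq> 0 \<and> F z \<noteq> 1) \<Longrightarrow>
       norm z\<^sub>0 = exp (- 2 * R) \<Longrightarrow> norm (F z\<^sub>0) \<le> 3 \<Longrightarrow> norm z = exp (- 2 * R) \<Longrightarrow>
       norm (F z - F z\<^sub>0) \<le> 1/3"
    using almost_constant_on_middle_circle [of 3 "1/3"] by auto
  define b where "b = exp (- 4 * R)"
  define \<rho> where "\<rho> = exp (- 2 * R)"
  have b: "0 < b" "b < \<rho>" "b < 1" and \<rho>: "0 < \<rho>" "\<rho> < 1"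
    using R by (simp_all add: b_def \<rho>_def)
  show thesis
  proof (rule that [OF b(1)], rule notI)
    fix \<alpha> :: "complex \<Rightarrow> complex"
    assume \<alpha>: "\<alpha> holomorphic_on ball 0 1" and \<alpha>0: "\<And>z. z \<in> ball 0 1 \<Longrightarrow> \<alpha> z \<noteq> 0"
      and ones: "\<forall>z\<in>ball 0 1. z * \<alpha> z = 1 \<longleftrightarrow> z\<^sup>2 + (of_real b)\<^sup>2 = 0"
    define F where "F = (\<lambda>z. z * \<alpha> z)"
    define c where "c = \<i> * complex_of_real b"
    have c: "norm c = b" "c \<noteq> 0" using b by (auto simp: c_def norm_mult)
    have F_c: "F c = 1" "F (- c) = 1"
      using bspec [OF ones, of c] bspec [OF ones, of "- c"] c b
      by (simp_all add: F_def) (simp_all add: c_def power_mult_distrib)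
    have disc: "cball 0 \<rho> \<subseteq> ball (0::complex) 1" using \<rho> by auto
    have F_holo: "F holomorphic_on ball 0 1"
      unfolding F_def by (intro holomorphic_intros \<alpha>)
    show False
    proof (cases "\<exists>z\<^sub>0. norm z\<^sub>0 = \<rho> \<and> norm (F z\<^sub>0) \<le> 3")
      case True
      then obtain z\<^sub>0 where z0: "norm z\<^sub>0 = \<rho>" "norm (F z\<^sub>0) \<le> 3" by auto
      have on_circle: "norm (F z - F z\<^sub>0) \<le> 1/3" if "norm z = \<rho>" for z
      proof (rule circle [of F])
        show "F holomorphic_on {z. exp (- 4 * R) < norm z \<and> norm z < 1}"
          using F_holo by (rule holomorphic_on_subset) auto
        show "F z \<noteq> 0 \<and> F z \<noteq> 1" if z: "exp (- 4 * R) < norm z" "norm z < 1" for z :: complex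
        proof
          show "F z \<noteq> 0" using \<alpha>0 [of z] z by (auto simp: F_def)
          have "norm (z\<^sup>2) \<noteq> norm (- (complex_of_real b)\<^sup>2)"
            using z b by (auto simp: norm_power power2_eq_iff_nonneg b_def)
          then show "F z \<noteq> 1"
            using ones z by (auto simp: F_def add_eq_0_iff2)
        qed
      qed (use z0 that in \<open>simp_all add: \<rho>_def\<close>)
      have inside: "norm (F z - F z\<^sub>0) \<le> 1/3" if "norm z \<le> \<rho>" for z
      proof (rule maximum_modulus_cball [of "\<lambda>z. F z - F z\<^sub>0"])
        show "(\<lambda>z. F z - F z\<^sub>0) holomorphic_on cball 0 \<rho>"
          by (intro holomorphic_intros holomorphic_on_subset [OF F_holo disc])
      qed (use \<rho> on_circle that in auto)
      have "norm (1 - F z\<^sub>0) \<le> 1/3" "norm (F z\<^sub>0) \<le> 1/3"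
        using inside [of c] inside [of 0] F_c c b \<rho> by (simp_all add: F_def)
      then have "norm (1 - F z\<^sub>0 + F z\<^sub>0) \<le> 1/3 + 1/3"
        by (intro norm_triangle_mono)
      then show False by simp
    next
      case False
      define \<phi> where "\<phi> = (\<lambda>z. 1 / \<alpha> z)"
      have "\<phi> holomorphic_on cball 0 \<rho>"
        unfolding \<phi>_def
        using disc \<alpha>0 by (intro holomorphic_intros holomorphic_on_subset [OF \<alpha> disc]) auto
      moreover have "norm (\<phi> z) \<le> \<rho> / 3" if z: "norm z = \<rho>" for z
      proof -
        have "3 \<le> \<rho> * norm (\<alpha> z)"
          using False z by (force simp: F_def norm_mult)
        moreover have "norm (\<alpha> z) > 0" using \<alpha>0 [of z] z \<rho> by simp
        ultimately show ?thesis by (simp add: \<phi>_def norm_divide field_simps)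
      qed
      moreover have "\<phi> c = c" "\<phi> (- c) = - c"
        using F_c c \<alpha>0 [of c] \<alpha>0 [of "- c"] b by (auto simp: \<phi>_def F_def field_simps)
      ultimately show False
        using no_opposite_fixed_points [of \<phi> \<rho> c] \<rho> c b by auto
    qed
  qed
qed

section \<open>The pair\<close>

theorem corollary0p4:
  shows "\<exists>f g. (f, g) \<in> invertible_pairs \<and>
           positive_on f (real_zeros g) \<and> positive_on g (real_zeros f) \<and>
           (\<forall>\<alpha>\<in>real_disc_algebra. \<forall>\<beta>\<in>real_disc_algebra.
              bezout_on_disc \<alpha> \<beta> f g \<longrightarrow>
              \<not> invertible_in_real_disc_algebra \<alpha> \<or> \<not> invertible_in_real_disc_algebra \<beta>)"
proof -
  obtain b :: real where b: "0 < b"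
    and obstruction: "\<And>\<alpha>. \<alpha> holomorphic_on ball 0 1 \<Longrightarrow> (\<And>z. z \<in> ball 0 1 \<Longrightarrow> \<alpha> z \<noteq> 0) \<Longrightarrow>
       \<not> (\<forall>z\<in>ball 0 1. z * \<alpha> z = 1 \<longleftrightarrow> z\<^sup>2 + (of_real b)\<^sup>2 = 0)"
    using zero_free_multiple_of_identity_obstruction by metis
  define f :: "complex \<Rightarrow> complex" where "f = (\<lambda>z. z)"
  define g :: "complex \<Rightarrow> complex" where "g = (\<lambda>z. z\<^sup>2 + (of_real b)\<^sup>2)"
  have mem: "f \<in> real_disc_algebra" "g \<in> real_disc_algebra"
    "(\<lambda>z. - z / (of_real b)\<^sup>2) \<in> real_disc_algebra" "(\<lambda>z. 1 / (of_real b)\<^sup>2) \<in> real_disc_algebra"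
    using b by (auto simp: real_disc_algebra_def disc_algebra_def f_def g_def
        intro!: continuous_intros holomorphic_intros)
  have "bezout_on_disc (\<lambda>z. - z / (of_real b)\<^sup>2) (\<lambda>z. 1 / (of_real b)\<^sup>2) f g"
    using b by (auto simp: bezout_on_disc_def f_def g_def field_simps power2_eq_square)
  then have "(f, g) \<in> invertible_pairs"
    using mem by (auto simp: invertible_pairs_def)
  moreover have "g (of_real x) \<noteq> 0" for x
  proof -
    have "g (of_real x) = of_real (x\<^sup>2 + b\<^sup>2)" by (simp add: g_def)
    then show ?thesis using b by (simp only: of_real_eq_0_iff) (simp add: sum_power2_eq_zero_iff)
  qed
  then have "positive_on f (real_zeros g)"
    by (simp add: positive_on_def real_zeros_def)
  moreover have "positive_on g (real_zeros f)"
    using b by (auto simp: positive_on_def real_zeros_def f_def g_def simp flip: of_real_power)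
  moreover have False
    if "\<alpha> \<in> real_disc_algebra" and bezout: "bezout_on_disc \<alpha> \<beta> f g"
      and inv: "invertible_in_real_disc_algebra \<alpha>" "invertible_in_real_disc_algebra \<beta>" for \<alpha> \<beta>
  proof -
    have nonzero: "\<alpha> z \<noteq> 0" "\<beta> z \<noteq> 0" if "z \<in> ball 0 1" for z
      using inv that unfolding invertible_in_real_disc_algebra_def
      by (metis ball_subset_cball mult_zero_left subsetD zero_neq_one)+
    have "\<alpha> holomorphic_on ball 0 1"
      using that(1) by (simp add: real_disc_algebra_def disc_algebra_def)
    moreover have "z * \<alpha> z = 1 \<longleftrightarrow> z\<^sup>2 + (of_real b)\<^sup>2 = 0" if "z \<in> ball 0 1" for z
    proof -
      have "\<alpha> z * z + \<beta> z * (z\<^sup>2 + (of_real b)\<^sup>2) = 1"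
        using bezout that by (simp add: bezout_on_disc_def f_def g_def)
      then show ?thesis
        using nonzero [OF that]
        by (metis add_cancel_left_right mult.commute mult_eq_0_iff)
    qed
    ultimately show False
      using obstruction [of \<alpha>] nonzero by blast
  qed
  ultimately show ?thesis by blast
qed

end
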